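(* Every cancellative commutative monoid is surjunctive. In particular, the additive monoid $\mathbb{N}$ of non-negative integers is surjunctive.
   Context: A monoid $M$ is cancellative if for every $m\in M$ the maps $m'\mapsto mm'$ and $m'\mapsto m'm$ from $M$ to $M$ are injective. Let $M$ be a monoid and $A$ a set. The set $A^M$ of all maps $x\colon M\to A$ carries the shift action of $M$ given by $(mx)(m') := x(m'm)$ for $m,m'\in M$, and the prodiscrete uniform structure, for which a base of entourages is given by the sets $W_F := \{(x,y)\in A^M\times A^M : x|_F = y|_F\}$, $F$ running over all finite subsets of $M$. A cellular automaton over $M$ with alphabet $A$ is a map $\tau\colon A^M\to A^M$ that is $M$-equivariant ($\tau(mx)=m\tau(x)$ for all $m\in M$, $x\in A^M$) and uniformly continuous. The monoid $M$ is called surjunctive if, for every finite set $A$, every injective cellular automaton $\tau\colon A^M\to A^M$ is surjective. *)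

theory Defs
  imports Complex_Main "HOL-Algebra.Divisibility" "HOL-Library.FuncSet"
begin

text \<open>
  A monoid \<open>M\<close> is a record in the sense of HOL-Algebra; ``cancellative commutative monoid'' is the
  library locale \<^locale>\<open>comm_monoid_cancel\<close>. The set \<open>A\<^sup>M\<close> is the extensional function space
  \<open>carrier M \<rightarrow>\<^sub>E A\<close>, so that equality of configurations is equality as maps on \<open>carrier M\<close>.
\<close>

abbreviation configs :: "('m, 'r) monoid_scheme \<Rightarrow> 'a set \<Rightarrow> ('m \<Rightarrow> 'a) set" where
  "configs M A \<equiv> carrier M \<rightarrow>\<^sub>E A"

definition shift :: "('m, 'r) monoid_scheme \<Rightarrow> 'm \<Rightarrow> ('m \<Rightarrow> 'a) \<Rightarrow> ('m \<Rightarrow> 'a)" where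
  "shift M m x = (\<lambda>m'\<in>carrier M. x (m' \<otimes>\<^bsub>M\<^esub> m))"

definition prodiscrete_entourage ::
    "('m, 'r) monoid_scheme \<Rightarrow> 'a set \<Rightarrow> 'm set \<Rightarrow> (('m \<Rightarrow> 'a) \<times> ('m \<Rightarrow> 'a)) set" where
  "prodiscrete_entourage M A F =
     {(x, y) \<in> configs M A \<times> configs M A. restrict x F = restrict y F}"

text \<open>
  As for the type class \<^class>\<open>uniform_space\<close>, a uniform structure is given by its filter of
  entourages. The class itself cannot be used, since \<open>configs M A\<close> is a set and not a type.
\<close>

definition prodiscrete_uniformity ::
    "('m, 'r) monoid_scheme \<Rightarrow> 'a set \<Rightarrow> (('m \<Rightarrow> 'a) \<times> ('m \<Rightarrow> 'a)) filter" where
  "prodiscrete_uniformity M A =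
     (INF F\<in>{F. finite F \<and> F \<subseteq> carrier M}. principal (prodiscrete_entourage M A F))"

lemma eventually_prodiscrete_uniformity:
  "eventually P (prodiscrete_uniformity M A) \<longleftrightarrow>
     (\<exists>F. finite F \<and> F \<subseteq> carrier M \<and> (\<forall>p\<in>prodiscrete_entourage M A F. P p))"
proof -
  have "prodiscrete_entourage M A (F \<union> G) \<subseteq> prodiscrete_entourage M A F \<inter> prodiscrete_entourage M A G"
    for F G
    by (auto simp: prodiscrete_entourage_def fun_eq_iff restrict_def split: if_splits)
  then have "\<exists>H\<in>{F. finite F \<and> F \<subseteq> carrier M}. principal (prodiscrete_entourage M A H) \<le>
      inf (principal (prodiscrete_entourage M A F)) (principal (prodiscrete_entourage M A G))"
    if "F \<in> {F. finite F \<and> F \<subseteq> carrier M}" "G \<in> {F. finite F \<and> F \<subseteq> carrier M}" for F G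
    using that by (intro bexI[of _ "F \<union> G"]) auto
  then have "eventually P (prodiscrete_uniformity M A) \<longleftrightarrow>
     (\<exists>F\<in>{F. finite F \<and> F \<subseteq> carrier M}. eventually P (principal (prodiscrete_entourage M A F)))"
    unfolding prodiscrete_uniformity_def by (intro eventually_INF_base) auto
  then show ?thesis
    by (auto simp: eventually_principal)
qed

definition cellular_automaton ::
    "('m, 'r) monoid_scheme \<Rightarrow> 'a set \<Rightarrow> (('m \<Rightarrow> 'a) \<Rightarrow> ('m \<Rightarrow> 'a)) \<Rightarrow> bool" where
  "cellular_automaton M A \<tau> \<longleftrightarrow>
     \<tau> \<in> configs M A \<rightarrow> configs M A \<and>
     (\<forall>m\<in>carrier M. \<forall>x\<in>configs M A. \<tau> (shift M m x) = shift M m (\<tau> x)) \<and>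
     (LIM (x, y) prodiscrete_uniformity M A. (\<tau> x, \<tau> y) :> prodiscrete_uniformity M A)"

text \<open>
  A predicate in HOL cannot quantify over finite sets of all types, so the type of alphabet symbols
  is a parameter. Theorems about \<open>surjunctive TYPE('a) M\<close> are to be stated for an arbitrary \<open>'a\<close>.
\<close>

definition surjunctive :: "'a itself \<Rightarrow> ('m, 'r) monoid_scheme \<Rightarrow> bool" where
  "surjunctive (_ :: 'a itself) M \<longleftrightarrow>
     (\<forall>(A :: 'a set) \<tau>. finite A \<longrightarrow> cellular_automaton M A \<tau> \<longrightarrow>
        inj_on \<tau> (configs M A) \<longrightarrow> \<tau> ` configs M A = configs M A)"

definition nat_add_monoid :: "nat monoid" where
  "nat_add_monoid = \<lparr>carrier = UNIV, monoid.mult = (+), one = 0\<rparr>"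

lemma comm_monoid_cancel_nat_add_monoid: "comm_monoid_cancel nat_add_monoid"
  by unfold_locales (auto simp: nat_add_monoid_def)

end

theory Submission
  imports Defs "HOL-Algebra.FiniteProduct" "HOL-Analysis.Product_Topology" "HOL-Real_Asymp.Real_Asymp"
begin

text \<open>
  Let \<open>\<tau>\<close> be an injective cellular automaton that is not surjective. By compactness there are finite
  sets \<open>N\<close> and \<open>P\<close> such that \<open>\<tau> x\<close> on \<open>N\<close> determines \<open>x \<one>\<close>, and such that some pattern on \<open>P\<close> occurs
  in no \<open>\<tau> x\<close>. Put \<open>S = {\<one>} \<union> N \<union> P\<close>. Since word balls grow polynomially, there are
  finite sets \<open>E\<close> for which \<open>|S E| / |E|\<close> is as close to \<open>1\<close> as desired. The patterns of
  the images \<open>\<tau> x\<close> on \<open>S E\<close> determine \<open>x\<close> on \<open>E\<close>, so there are at least \<open>|A|\<close> to the power \<open>|E|\<close> of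
  them. On the other hand they avoid the forbidden pattern on at least \<open>|E| / |P|\<^sup>2\<close> disjoint
  translates of \<open>P\<close>, and each translate costs a constant factor less than \<open>1\<close>: there are too few
  patterns.
\<close>

section \<open>Compactness of the prodiscrete topology\<close>

text \<open>By Tychonoff, \<open>I \<rightarrow>\<^sub>E A\<close> is compact as a product of finite
  discrete spaces. The closures of the sets \<open>Q F\<close> have the finite intersection
  property, and any \<open>z\<close> in all of them works, since each cylinder around
  \<open>z\<close> meets \<open>Q F\<close>.\<close>

lemma PiE_cluster_point:
  fixes Q :: "'i set \<Rightarrow> ('i \<Rightarrow> 'a) set"
  assumes A: "finite A"
    and Q: "\<And>F. finite F \<Longrightarrow> F \<subseteq> I \<Longrightarrow> Q F \<subseteq> I \<rightarrow>\<^sub>E A \<and> Q F \<noteq> {}"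
    and anti: "\<And>F G. finite G \<Longrightarrow> F \<subseteq> G \<Longrightarrow> G \<subseteq> I \<Longrightarrow> Q G \<subseteq> Q F"
  obtains z where "z \<in> I \<rightarrow>\<^sub>E A"
    and "\<And>F. finite F \<Longrightarrow> F \<subseteq> I \<Longrightarrow> \<exists>x\<in>Q F. \<forall>i\<in>F. x i = z i"
proof -
  define X where "X = product_topology (\<lambda>_. discrete_topology A) I"
  define \<F> where "\<F> = {F. finite F \<and> F \<subseteq> I}"
  define \<U> where "\<U> = (\<lambda>F. X closure_of Q F) ` \<F>"
  have top: "topspace X = I \<rightarrow>\<^sub>E A"
    by (simp add: X_def)
  have "compact_space X"
    unfolding X_def by (simp add: compact_space_product_topology compact_space_discrete_topology A)
  moreover have "\<forall>C\<in>\<U>. closedin X C"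
    by (auto simp: \<U>_def)
  moreover have "\<forall>\<V>. finite \<V> \<and> \<V> \<subseteq> \<U> \<longrightarrow> \<Inter>\<V> \<noteq> {}"
  proof (intro allI impI)
    fix \<V> assume "finite \<V> \<and> \<V> \<subseteq> \<U>"
    then obtain \<H> where \<H>: "\<H> \<subseteq> \<F>" "finite \<H>" "\<V> = (\<lambda>F. X closure_of Q F) ` \<H>"
      unfolding \<U>_def by (meson finite_subset_image)
    \<comment> \<open>The union of the finitely many windows is again a window; by
      \<open>anti\<close>, its \<open>Q\<close> lies in every \<open>Q F\<close> with
      \<open>F \<in> \<H>\<close>.\<close>
    have un: "finite (\<Union>\<H>)" "\<Union>\<H> \<subseteq> I"
      using \<H> by (auto simp: \<F>_def)
    then obtain x where x: "x \<in> Q (\<Union>\<H>)"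
      using Q by blast
    have "x \<in> X closure_of Q F" if "F \<in> \<H>" for F
    proof -
      have F: "finite F" "F \<subseteq> I"
        using that \<H>(1) by (auto simp: \<F>_def)
      have "x \<in> Q F"
        using anti[OF un(1) _ un(2), of F] that x by auto
      moreover have "Q F \<subseteq> X closure_of Q F"
        using Q[OF F] by (simp add: closure_of_subset top)
      ultimately show ?thesis by blast
    qed
    then show "\<Inter>\<V> \<noteq> {}"
      using \<H>(3) by auto
  qed
  ultimately have "\<Inter>\<U> \<noteq> {}"
    by (auto simp: compact_space_fip)
  then obtain z where z: "\<And>F. F \<in> \<F> \<Longrightarrow> z \<in> X closure_of Q F"
    by (auto simp: \<U>_def)
  have zI: "z \<in> I \<rightarrow>\<^sub>E A"
    using z[of "{}"] by (auto simp: \<F>_def in_closure_of top)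
  show thesis
  proof (rule that[OF zI])
    fix F assume F: "finite F" "F \<subseteq> I"
    \<comment> \<open>The cylinder of configurations agreeing with \<open>z\<close> on
      \<open>F\<close>; it is open because only finitely many coordinates are constrained.\<close>
    define V where "V = (\<Pi>\<^sub>E i\<in>I. if i \<in> F then {z i} else A)"
    have "finite {i \<in> I. (if i \<in> F then {z i} else A) \<noteq> A}"
      by (rule finite_subset[OF _ F(1)]) auto
    then have "openin X V"
      unfolding X_def V_def using zI by (auto simp: openin_PiE_gen PiE_mem)
    moreover have "z \<in> V"
      using zI by (auto simp: V_def PiE_iff)
    moreover have "z \<in> X closure_of Q F"
      using z F by (simp add: \<F>_def)
    ultimately obtain x where "x \<in> Q F" "x \<in> V"
      by (auto simp: in_closure_of)
    then show "\<exists>x\<in>Q F. \<forall>i\<in>F. x i = z i"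
      using F(2) by (intro bexI[of _ x]) (auto simp: V_def PiE_iff split: if_splits)
  qed
qed

section \<open>Cellular automata\<close>

text \<open>Uniform continuity, tested on the entourage of the single coordinate \<open>m\<close>,
  yields a finite memory set \<open>G\<close>.\<close>

lemma cellular_automaton_local:
  assumes \<tau>: "cellular_automaton M A \<tau>" and m: "m \<in> carrier M"
  obtains G where "finite G" "G \<subseteq> carrier M"
    "\<And>x y. x \<in> configs M A \<Longrightarrow> y \<in> configs M A \<Longrightarrow> (\<And>k. k \<in> G \<Longrightarrow> x k = y k) \<Longrightarrow>
       \<tau> x m = \<tau> y m"
proof -
  have "eventually (\<lambda>p. p \<in> prodiscrete_entourage M A {m}) (prodiscrete_uniformity M A)"
    using m by (auto simp: eventually_prodiscrete_uniformity intro!: exI[of _ "{m}"])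
  moreover have "LIM (x, y) prodiscrete_uniformity M A. (\<tau> x, \<tau> y) :> prodiscrete_uniformity M A"
    using \<tau> by (simp add: cellular_automaton_def)
  ultimately have "eventually (\<lambda>p. (case p of (x, y) \<Rightarrow> (\<tau> x, \<tau> y)) \<in> prodiscrete_entourage M A {m})
      (prodiscrete_uniformity M A)"
    by (rule eventually_compose_filterlim)
  then obtain G where G: "finite G" "G \<subseteq> carrier M"
    "\<And>x y. (x, y) \<in> prodiscrete_entourage M A G \<Longrightarrow> (\<tau> x, \<tau> y) \<in> prodiscrete_entourage M A {m}"
    unfolding eventually_prodiscrete_uniformity by fast
  show thesis
  proof (rule that[OF G(1,2)])
    fix x y assume "x \<in> configs M A" "y \<in> configs M A" "\<And>k. k \<in> G \<Longrightarrow> x k = y k"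
    then have "(\<tau> x, \<tau> y) \<in> prodiscrete_entourage M A {m}"
      by (intro G(3)) (auto simp: prodiscrete_entourage_def restrict_def)
    then show "\<tau> x m = \<tau> y m"
      by (auto simp: prodiscrete_entourage_def dest: fun_cong[of _ _ m])
  qed
qed

text \<open>The image of the compact space is closed, so a point \<open>w\<close> outside it is
  already separated from it on a finite window. Concretely, a cluster point of approximate preimages
  of \<open>w\<close> would be a preimage.\<close>

lemma cellular_automaton_closed_image:
  assumes \<tau>: "cellular_automaton M A \<tau>" and A: "finite A"
    and w: "w \<in> configs M A" "w \<notin> \<tau> ` configs M A"
  obtains P where "finite P" "P \<subseteq> carrier M"
    "\<And>x. x \<in> configs M A \<Longrightarrow> \<exists>m\<in>P. \<tau> x m \<noteq> w m"
proof (rule ccontr)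
  assume neg: "\<not> thesis"
  note closed_image = that
  have ex: "\<exists>x\<in>configs M A. \<forall>m\<in>P. \<tau> x m = w m" if P: "finite P" "P \<subseteq> carrier M" for P
    using neg closed_image[OF P] by blast
  obtain z where z: "z \<in> configs M A"
    "\<And>F. finite F \<Longrightarrow> F \<subseteq> carrier M \<Longrightarrow>
       \<exists>x\<in>{x \<in> configs M A. \<forall>m\<in>F. \<tau> x m = w m}. \<forall>m\<in>F. x m = z m"
  proof (rule PiE_cluster_point[of A "carrier M" "\<lambda>F. {x \<in> configs M A. \<forall>m\<in>F. \<tau> x m = w m}"])
    show "{x \<in> configs M A. \<forall>m\<in>F. \<tau> x m = w m} \<subseteq> configs M A \<and>
        {x \<in> configs M A. \<forall>m\<in>F. \<tau> x m = w m} \<noteq> {}" if "finite F" "F \<subseteq> carrier M" for F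
      using ex[OF that] by auto
  qed (use A in auto)
  have "\<tau> z m = w m" if m: "m \<in> carrier M" for m
  proof -
    obtain G where G: "finite G" "G \<subseteq> carrier M"
      "\<And>x y. x \<in> configs M A \<Longrightarrow> y \<in> configs M A \<Longrightarrow> (\<And>k. k \<in> G \<Longrightarrow> x k = y k) \<Longrightarrow>
         \<tau> x m = \<tau> y m"
      using cellular_automaton_local[OF \<tau> m] by blast
    obtain x where "x \<in> configs M A" "\<forall>m\<in>insert m G. \<tau> x m = w m" "\<forall>m\<in>insert m G. x m = z m"
      \<comment> \<open>The window contains \<open>G\<close> so that \<open>x\<close> and
        \<open>z\<close> have the same image at \<open>m\<close>, and \<open>m\<close> so that this
        common value is \<open>w m\<close>.\<close>
      using z(2)[of "insert m G"] G(1,2) m by auto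
    then show ?thesis
      using G(3)[of x z] z(1) by auto
  qed
  moreover have "\<tau> z \<in> configs M A"
    using \<tau> z(1) by (auto simp: cellular_automaton_def)
  ultimately have "\<tau> z = w"
    using w(1) by (intro PiE_ext) auto
  then show False
    using w(2) z(1) by blast
qed

text \<open>The inverse of \<tau> on its image is continuous, again by compactness: pairs that
  differ at \<open>e\<close> while their images agree on ever larger windows cluster at two distinct
  configurations with equal images.\<close>

lemma cellular_automaton_local_inverse:
  assumes \<tau>: "cellular_automaton M A \<tau>" and A: "finite A"
    and inj: "inj_on \<tau> (configs M A)" and e: "e \<in> carrier M"
  obtains N where "finite N" "N \<subseteq> carrier M"
    "\<And>x y. x \<in> configs M A \<Longrightarrow> y \<in> configs M A \<Longrightarrow> (\<And>m. m \<in> N \<Longrightarrow> \<tau> x m = \<tau> y m) \<Longrightarrow> x e = y e"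
proof (rule ccontr)
  assume neg: "\<not> thesis"
  note local_inverse = that
  \<comment> \<open>A pair of configurations is encoded as one configuration over
    \<open>A \<times> A\<close>, so that \<open>PiE_cluster_point\<close> applies; \<open>l\<close>
    and \<open>r\<close> recover its two components.\<close>
  define l where "l z = (\<lambda>m\<in>carrier M. fst (z m))" for z :: "'a \<Rightarrow> 'c \<times> 'c"
  define r where "r z = (\<lambda>m\<in>carrier M. snd (z m))" for z :: "'a \<Rightarrow> 'c \<times> 'c"
  define Q where "Q F = {z \<in> configs M (A \<times> A).
      (\<forall>m\<in>F. \<tau> (l z) m = \<tau> (r z) m) \<and> l z e \<noteq> r z e}" for F
  have lr: "l z \<in> configs M A" "r z \<in> configs M A" if "z \<in> configs M (A \<times> A)" for z
    using that by (auto simp: l_def r_def PiE_iff mem_Times_iff)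
  have ex: "Q F \<noteq> {}" if F: "finite F" "F \<subseteq> carrier M" for F
  proof -
    obtain x y where xy: "x \<in> configs M A" "y \<in> configs M A"
      "\<And>m. m \<in> F \<Longrightarrow> \<tau> x m = \<tau> y m" "x e \<noteq> y e"
      using neg local_inverse[OF F] by blast
    define z where "z = (\<lambda>m\<in>carrier M. (x m, y m))"
    have "l z = x" "r z = y"
      using xy(1,2) by (auto simp: l_def r_def z_def PiE_def extensional_def fun_eq_iff)
    moreover have "z \<in> configs M (A \<times> A)"
      using xy(1,2) by (auto simp: z_def)
    ultimately have "z \<in> Q F"
      using xy(3,4) by (simp add: Q_def)
    then show ?thesis by blast
  qed
  obtain z where z: "z \<in> configs M (A \<times> A)"
    "\<And>F. finite F \<Longrightarrow> F \<subseteq> carrier M \<Longrightarrow> \<exists>x\<in>Q F. \<forall>m\<in>F. x m = z m"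
  proof (rule PiE_cluster_point[of "A \<times> A" "carrier M" Q])
    show "Q F \<subseteq> configs M (A \<times> A) \<and> Q F \<noteq> {}" if "finite F" "F \<subseteq> carrier M" for F
      using ex[OF that] by (auto simp: Q_def)
    show "Q G \<subseteq> Q F" if "F \<subseteq> G" for F G
      using that by (auto simp: Q_def)
  qed (use A in auto)
  have "\<tau> (l z) m = \<tau> (r z) m \<and> l z e \<noteq> r z e" if m: "m \<in> carrier M" for m
  proof -
    obtain G where G: "finite G" "G \<subseteq> carrier M"
      "\<And>x y. x \<in> configs M A \<Longrightarrow> y \<in> configs M A \<Longrightarrow> (\<And>k. k \<in> G \<Longrightarrow> x k = y k) \<Longrightarrow>
         \<tau> x m = \<tau> y m"
      using cellular_automaton_local[OF \<tau> m] by blast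
    \<comment> \<open>Including \<open>e\<close> in the window lets the difference at
      \<open>e\<close> pass to the limit \<open>z\<close>.\<close>
    obtain x where x: "x \<in> Q (insert e (insert m G))" "\<forall>m\<in>insert e (insert m G). x m = z m"
      using z(2)[of "insert e (insert m G)"] G(1,2) m e by auto
    have xc: "x \<in> configs M (A \<times> A)"
      using x(1) by (simp add: Q_def)
    have eq: "l x k = l z k" "r x k = r z k" if "k \<in> insert e (insert m G)" for k
      using bspec[OF x(2) that] by (simp_all add: l_def r_def)
    have "\<tau> (l x) m = \<tau> (l z) m" "\<tau> (r x) m = \<tau> (r z) m"
      using G(3)[of "l x" "l z"] G(3)[of "r x" "r z"] lr[OF xc] lr[OF z(1)] eq by auto
    then show ?thesis
      using x(1) eq[of e] by (auto simp: Q_def)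
  qed
  note * = this
  have "\<tau> (l z) = \<tau> (r z)"
    using * \<tau> lr[OF z(1)] by (intro PiE_ext[of _ "carrier M" "\<lambda>_. A"]) (auto simp: cellular_automaton_def)
  then have "l z = r z"
    using inj lr[OF z(1)] by (auto dest: inj_onD)
  then show False
    using *[OF e] by simp
qed

section \<open>Growth and packing in cancellative commutative monoids\<close>

context comm_monoid
begin

text \<open>Products of exactly \<open>n\<close> factors from \<open>S\<close>; these sets increase
  with \<open>n\<close> when \<open>\<one> \<in> S\<close>, as in the application.\<close>

fun word_ball :: "'a set \<Rightarrow> nat \<Rightarrow> 'a set" where
  "word_ball S 0 = {\<one>}"
| "word_ball S (Suc n) = (\<lambda>(s, e). s \<otimes> e) ` (S \<times> word_ball S n)"

lemma finite_word_ball: "finite S \<Longrightarrow> finite (word_ball S n)"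
  by (induction n) auto

lemma word_ball_carrier: "S \<subseteq> carrier G \<Longrightarrow> word_ball S n \<subseteq> carrier G"
  by (induction n) auto

lemma word_ball_nonempty: "S \<noteq> {} \<Longrightarrow> word_ball S n \<noteq> {}"
  by (induction n) auto

text \<open>By commutativity a word is determined by how often each letter occurs, and no letter of
  a word of length \<open>n\<close> occurs more than \<open>n\<close> times. This is the source of
  polynomial growth.\<close>

lemma word_ball_subset_finprod:
  assumes S: "finite S" "S \<subseteq> carrier G"
  shows "word_ball S n \<subseteq> (\<lambda>f. \<Otimes>s\<in>S. s [^] (f s :: nat)) ` (S \<rightarrow>\<^sub>E {0..n})"
proof (induction n)
  case 0
  have "(\<Otimes>s\<in>S. s [^] ((\<lambda>s\<in>S. 0) s :: nat)) = \<one>"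
    by (intro finprod_one_eqI) auto
  then show ?case
    by (auto intro!: image_eqI[of _ _ "\<lambda>s\<in>S. 0"])
next
  case (Suc n)
  show ?case
  proof
    fix x assume "x \<in> word_ball S (Suc n)"
    then obtain s f where s: "s \<in> S" and f: "f \<in> S \<rightarrow>\<^sub>E {0..n}"
      and x: "x = s \<otimes> (\<Otimes>t\<in>S. t [^] (f t :: nat))"
      using Suc by auto
    define g where "g = f(s := Suc (f s))"
    have "(\<Otimes>t\<in>S. t [^] g t) = (\<Otimes>t\<in>S. (if t = s then s else \<one>) \<otimes> t [^] f t)"
      using S s by (intro finprod_cong') (auto simp: g_def subset_iff m_comm)
    also have "\<dots> = (\<Otimes>t\<in>S. if t = s then s else \<one>) \<otimes> (\<Otimes>t\<in>S. t [^] f t)"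
      using S s by (intro finprod_multf) auto
    also have "(\<Otimes>t\<in>S. if t = s then s else \<one>) = s"
      using finprod_singleton_swap[of s S "\<lambda>_. s"] S s by auto
    finally have "x = (\<Otimes>t\<in>S. t [^] g t)"
      using x by simp
    moreover have "g \<in> S \<rightarrow>\<^sub>E {0..Suc n}"
      using f s by (auto simp: g_def PiE_iff extensional_def le_SucI)
    ultimately show "x \<in> (\<lambda>f. \<Otimes>s\<in>S. s [^] (f s :: nat)) ` (S \<rightarrow>\<^sub>E {0..Suc n})"
      by blast
  qed
qed

lemma card_word_ball_le:
  assumes S: "finite S" "S \<subseteq> carrier G"
  shows "card (word_ball S n) \<le> Suc n ^ card S"
proof -
  have fin: "finite (S \<rightarrow>\<^sub>E {0..n})"
    using S by (intro finite_PiE) auto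
  have "card (word_ball S n) \<le> card (S \<rightarrow>\<^sub>E {0..n})"
    by (rule surj_card_le[OF fin word_ball_subset_finprod[OF S]])
  also have "\<dots> = Suc n ^ card S"
    using S by (simp add: card_PiE)
  finally show ?thesis .
qed

text \<open>If every word ball were followed by one larger by the factor \<open>1 + 1 / L\<close>, the growth of \<open>S\<close>
  would be exponential; but commutativity makes it polynomial.\<close>

lemma exists_almost_invariant:
  assumes S: "finite S" "S \<subseteq> carrier G" "S \<noteq> {}" and L: "L > 0"
  obtains E where "finite E" "E \<subseteq> carrier G" "E \<noteq> {}"
    "L * card ((\<lambda>(s, e). s \<otimes> e) ` (S \<times> E)) \<le> (L + 1) * card E"
proof (rule ccontr)
  assume neg: "\<not> thesis"
  define c where "c = (real L + 1) / real L"
  have c: "c > 1"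
    using L by (simp add: c_def)
  \<comment> \<open>The failing inequality is used for \<open>E = word_ball S n\<close>, for which
    the product set is the next word ball.\<close>
  have step: "L * card (word_ball S (Suc n)) > (L + 1) * card (word_ball S n)" for n
    using neg that[OF finite_word_ball[OF S(1)] word_ball_carrier[OF S(2)] word_ball_nonempty[OF S(3)]]
    by (metis not_le word_ball.simps(2))
  have "c ^ n \<le> card (word_ball S n)" for n
  proof (induction n)
    case (Suc n)
    have "real ((L + 1) * card (word_ball S n)) \<le> real (L * card (word_ball S (Suc n)))"
      using step[of n] by (intro of_nat_mono) auto
    then have "c * card (word_ball S n) \<le> card (word_ball S (Suc n))"
      using L by (simp add: c_def field_simps)
    moreover have "c ^ Suc n \<le> c * card (word_ball S n)"
      using Suc c by simp
    ultimately show ?case by linarith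
  qed simp
  moreover have "real (card (word_ball S n)) \<le> real (Suc n) ^ card S" for n
    using card_word_ball_le[OF S(1,2), of n] by (metis of_nat_le_iff of_nat_power)
  ultimately have le: "c ^ n \<le> real (Suc n) ^ card S" for n
    by (meson order_trans)
  have "eventually (\<lambda>n. c ^ n > real (Suc n) ^ card S) sequentially"
    using c by real_asymp
  then show False
    using le by (auto simp: eventually_sequentially not_less[symmetric])
qed

end

text \<open>Take a maximal \<open>T\<close>. The translate of \<open>P\<close> by any
  \<open>e \<in> E\<close> then meets one by some \<open>t \<in> T\<close>, giving
  \<open>p \<otimes> e = p' \<otimes> t\<close>. By cancellation the triple
  \<open>((p, p'), t)\<close> determines \<open>e\<close>, so \<open>E\<close> injects into
  \<open>(P \<times> P) \<times> T\<close>.\<close>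

lemma (in comm_monoid_cancel) exists_packing:
  assumes E: "finite E" "E \<subseteq> carrier G" and P: "finite P" "P \<subseteq> carrier G" "P \<noteq> {}"
  obtains T where "T \<subseteq> E" "disjoint_family_on (\<lambda>t. (\<lambda>p. p \<otimes> t) ` P) T"
    "card E \<le> card P ^ 2 * card T"
proof -
  define \<T> where "\<T> = {T. T \<subseteq> E \<and> disjoint_family_on (\<lambda>t. (\<lambda>p. p \<otimes> t) ` P) T}"
  have "finite \<T>"
    by (rule finite_subset[of _ "Pow E"]) (auto simp: \<T>_def E)
  moreover have "{} \<in> \<T>"
    by (auto simp: \<T>_def disjoint_family_on_def)
  ultimately obtain T where T: "T \<in> \<T>" and max: "\<And>T'. T' \<in> \<T> \<Longrightarrow> T \<subseteq> T' \<Longrightarrow> T = T'"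
    using finite_has_maximal[of \<T>] by blast
  have "\<exists>q. fst q \<in> P \<times> P \<and> snd q \<in> T \<and> fst (fst q) \<otimes> e = snd (fst q) \<otimes> snd q" if e: "e \<in> E" for e
  proof (cases "e \<in> T")
    case True
    then show ?thesis using P(3) by fastforce
  next
    case False
    then have "insert e T \<notin> \<T>"
      using max by blast
    then have "\<exists>t\<in>T. (\<lambda>p. p \<otimes> t) ` P \<inter> (\<lambda>p. p \<otimes> e) ` P \<noteq> {}"
      using T e False by (auto simp: \<T>_def disjoint_family_on_insert)
    then show ?thesis
      by fastforce
  qed
  then obtain h where h: "\<And>e. e \<in> E \<Longrightarrow> fst (h e) \<in> P \<times> P \<and> snd (h e) \<in> T \<and>
      fst (fst (h e)) \<otimes> e = snd (fst (h e)) \<otimes> snd (h e)"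
    by metis
  have "inj_on h E"
  proof (rule inj_onI)
    fix d e assume de: "d \<in> E" "e \<in> E" "h d = h e"
    then have "fst (fst (h e)) \<otimes> d = fst (fst (h e)) \<otimes> e"
      using h[of d] h[of e] by simp
    moreover have "fst (fst (h e)) \<in> carrier G"
      using h[of e] de(2) P(2) by auto
    ultimately show "d = e"
      using de E(2) l_cancel by blast
  qed
  moreover have "h ` E \<subseteq> (P \<times> P) \<times> T"
    using h by (metis image_subsetI mem_Times_iff)
  moreover have "finite T"
    using T E(1) by (auto simp: \<T>_def intro: finite_subset)
  ultimately have "card E \<le> card ((P \<times> P) \<times> T)"
    using P(1) by (intro card_inj_on_le) auto
  then show thesis
    using T by (intro that[of T]) (auto simp: \<T>_def card_cartesian_product power2_eq_square)
qed

section \<open>Counting patterns\<close>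

text \<open>A function avoiding every \<open>v t\<close> amounts to arbitrary values off the blocks
  together with one of at most \<open>card A ^ p - 1\<close> patterns on each block. The bound is
  multiplied out so that it stays in the natural numbers.\<close>

lemma card_avoiding_le:
  assumes D: "finite D" and A: "finite A" and T: "finite T"
    and B: "\<And>t. t \<in> T \<Longrightarrow> B t \<subseteq> D" "\<And>t. t \<in> T \<Longrightarrow> card (B t) = p" "disjoint_family_on B T"
    and v: "\<And>t. t \<in> T \<Longrightarrow> v t \<in> B t \<rightarrow>\<^sub>E A"
  shows "card {f \<in> D \<rightarrow>\<^sub>E A. \<forall>t\<in>T. restrict f (B t) \<noteq> v t} * (card A ^ p) ^ card T
      \<le> card A ^ card D * (card A ^ p - 1) ^ card T"
proof -
  define X where "X = {f \<in> D \<rightarrow>\<^sub>E A. \<forall>t\<in>T. restrict f (B t) \<noteq> v t}"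
  define U where "U = (\<Union>t\<in>T. B t)"
  define Y where "Y = (D - U \<rightarrow>\<^sub>E A) \<times> (\<Pi>\<^sub>E t\<in>T. (B t \<rightarrow>\<^sub>E A) - {v t})"
  define h where "h f = (restrict f (D - U), \<lambda>t\<in>T. restrict f (B t))" for f :: "'a \<Rightarrow> 'b"
  have finB: "finite (B t)" if "t \<in> T" for t
    using B(1)[OF that] D finite_subset by blast
  have UD: "U \<subseteq> D" and finU: "finite U"
    using B(1) finB T by (auto simp: U_def)
  have cardU: "card U = p * card T"
    unfolding U_def using card_UN_disjoint[of T B] T finB B(2,3)
    by (simp add: disjoint_family_on_def mult.commute)
  have finBA: "finite (B t \<rightarrow>\<^sub>E A)" if "t \<in> T" for t
    using finB[OF that] A by (intro finite_PiE) auto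
  have cardB: "card ((B t \<rightarrow>\<^sub>E A) - {v t}) = card A ^ p - 1" if "t \<in> T" for t
    using that v finB B(2) by (simp add: card_PiE)
  have finY: "finite Y"
    unfolding Y_def using D A T finBA by (intro finite_cartesian_product finite_PiE) auto
  have "inj_on h X"
  proof (rule inj_onI)
    fix f g assume fg: "f \<in> X" "g \<in> X" "h f = h g"
    show "f = g"
    proof (rule PiE_ext[of _ D "\<lambda>_. A"])
      fix i assume i: "i \<in> D"
      show "f i = g i"
      proof (cases "i \<in> U")
        case True
        then obtain t where t: "t \<in> T" "i \<in> B t" by (auto simp: U_def)
        have "snd (h f) t i = snd (h g) t i" using fg(3) by simp
        then show ?thesis using t by (simp add: h_def)
      next
        case False
        have "fst (h f) i = fst (h g) i" using fg(3) by simp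
        then show ?thesis using i False by (simp add: h_def)
      qed
    qed (use fg in \<open>auto simp: X_def\<close>)
  qed
  moreover have "h ` X \<subseteq> Y"
    using B(1) by (fastforce simp: h_def X_def Y_def)
  ultimately have "card X \<le> card Y"
    using finY by (rule card_inj_on_le)
  also have "card Y = card A ^ card (D - U) * (card A ^ p - 1) ^ card T"
    unfolding Y_def card_cartesian_product using D T cardB by (simp add: card_PiE)
  finally have "card X * (card A ^ p) ^ card T
      \<le> card A ^ card (D - U) * (card A ^ p - 1) ^ card T * (card A ^ p) ^ card T"
    by (rule mult_right_mono) simp
  \<comment> \<open>The blocks are disjoint, so the factor \<open>(card A ^ p) ^ card T\<close>
    equals \<open>card A ^ card U\<close>.\<close>
  also have "\<dots> = card A ^ (card (D - U) + card U) * (card A ^ p - 1) ^ card T"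
    by (simp add: cardU power_add power_mult)
  also have "card (D - U) + card U = card D"
    using D UD finU by (simp add: card_Diff_subset card_mono)
  finally show ?thesis
    by (simp add: X_def)
qed

text \<open>Since \<open>((q - 1) / q) ^ r\<close> tends to 0, the loss from \<open>r\<close>
  forbidden blocks outweighs the gain \<open>a\<close> from one extra cell.\<close>

lemma exists_power_mult_less:
  fixes a q :: nat
  assumes "q > 0"
  obtains r where "r > 0" "a * (q - 1) ^ r < q ^ r"
proof -
  have "(\<lambda>r. real a * ((real q - 1) / real q) ^ r) \<longlonglongrightarrow> real a * 0"
    using assms by (intro tendsto_mult tendsto_const LIMSEQ_power_zero) (simp add: field_simps)
  then have "eventually (\<lambda>r. real a * ((real q - 1) / real q) ^ r < 1) sequentially"
    by (intro order_tendstoD(2)) auto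
  then have "eventually (\<lambda>r. r > 0 \<and> real a * ((real q - 1) / real q) ^ r < 1) sequentially"
    using eventually_gt_at_top[of 0] by eventually_elim auto
  then obtain r where r: "r > 0" "real a * ((real q - 1) / real q) ^ r < 1"
    using eventually_happens'[OF sequentially_bot] by blast
  then have "real a * (real q - 1) ^ r < real q ^ r"
    using assms by (simp add: power_divide field_simps)
  moreover have "real q - 1 = real (q - 1)"
    using assms by simp
  ultimately have "real (a * (q - 1) ^ r) < real (q ^ r)"
    by (metis of_nat_mult of_nat_power)
  then show thesis
    using r(1) that by (simp only: of_nat_less_iff)
qed

text \<open>Each of the \<open>d\<close> factors \<open>a\<close> is absorbed by its own group of
  \<open>r\<close> factors; the remaining \<open>t - r * d\<close> factors only help.\<close>

lemma power_mult_power_less: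
  fixes a q :: nat
  assumes "q > 0" "a * (q - 1) ^ r < q ^ r" "r * d \<le> t" "t > 0"
  shows "a ^ d * (q - 1) ^ t < q ^ t"
proof (cases "d = 0")
  \<comment> \<open>Here no group of \<open>r\<close> factors supplies strictness; it comes from
    \<open>t > 0\<close>.\<close>
  case True
  then show ?thesis
    using assms by (simp add: power_strict_mono)
next
  case False
  have t: "t = r * d + (t - r * d)"
    using assms(3) by simp
  have "a ^ d * (q - 1) ^ t = (a * (q - 1) ^ r) ^ d * (q - 1) ^ (t - r * d)"
    by (subst t) (simp add: power_add power_mult power_mult_distrib)
  also have "\<dots> \<le> (a * (q - 1) ^ r) ^ d * q ^ (t - r * d)"
    by (intro mult_left_mono power_mono) auto
  also have "\<dots> < (q ^ r) ^ d * q ^ (t - r * d)"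
    using assms(1,2) False by (intro mult_strict_right_mono power_strict_mono) auto
  also have "\<dots> = q ^ t"
    by (metis t power_add power_mult)
  finally show ?thesis .
qed

section \<open>Surjunctivity\<close>

theorem (in comm_monoid_cancel) surjunctive: "surjunctive TYPE('c) G"
  unfolding surjunctive_def
proof (intro allI impI)
  fix A :: "'c set" and \<tau> :: "('a \<Rightarrow> 'c) \<Rightarrow> 'a \<Rightarrow> 'c"
  assume A: "finite A" and \<tau>: "cellular_automaton G A \<tau>" and inj: "inj_on \<tau> (configs G A)"
  have \<tau>c: "\<tau> x \<in> configs G A" if "x \<in> configs G A" for x
    using \<tau> that by (auto simp: cellular_automaton_def)
  \<comment> \<open>Equivariance carries facts about the windows \<open>N\<close> and
    \<open>P\<close> over to their translates.\<close>
  have equiv: "\<tau> (shift G m x) k = \<tau> x (k \<otimes> m)"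
    if "m \<in> carrier G" "k \<in> carrier G" "x \<in> configs G A" for m k x
  proof -
    have "\<tau> (shift G m x) = shift G m (\<tau> x)"
      using \<tau> that by (auto simp: cellular_automaton_def)
    then show ?thesis
      using that by (simp add: shift_def)
  qed
  have shiftc: "shift G m x \<in> configs G A" if "m \<in> carrier G" "x \<in> configs G A" for m x
    using that by (auto simp: shift_def PiE_iff)
  show "\<tau> ` configs G A = configs G A"
  proof (rule ccontr)
    assume "\<tau> ` configs G A \<noteq> configs G A"
    then obtain w where w: "w \<in> configs G A" "w \<notin> \<tau> ` configs G A"
      using \<tau>c by blast
    obtain P where P: "finite P" "P \<subseteq> carrier G"
      and Pw: "\<And>x. x \<in> configs G A \<Longrightarrow> \<exists>m\<in>P. \<tau> x m \<noteq> w m"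
      by (rule cellular_automaton_closed_image[OF \<tau> A w]) blast
    obtain N where N: "finite N" "N \<subseteq> carrier G"
      and Nx: "\<And>x y. x \<in> configs G A \<Longrightarrow> y \<in> configs G A \<Longrightarrow>
        (\<And>m. m \<in> N \<Longrightarrow> \<tau> x m = \<tau> y m) \<Longrightarrow> x \<one> = y \<one>"
      by (rule cellular_automaton_local_inverse[OF \<tau> A inj one_closed]) blast
    have Pne: "P \<noteq> {}"
      using Pw[OF w(1)] by auto
    obtain a0 where a0: "a0 \<in> A"
      using w(1) one_closed by blast
    define a where "a = card A"
    define p where "p = card P"
    define q where "q = a ^ p"
    have a: "a > 0" and p: "p > 0" and q: "q > 0"
      using A a0 P(1) Pne by (auto simp: a_def p_def q_def card_gt_0_iff)
    obtain r where r: "r > 0" "a * (q - 1) ^ r < q ^ r"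
      using exists_power_mult_less[OF q] by blast
    \<comment> \<open>Chosen so that
      \<open>L * (card D - card E) \<le> card E \<le> p ^ 2 * card T\<close> yields at least
      \<open>r\<close> blocks for each extra cell of \<open>D\<close>.\<close>
    define L where "L = r * p ^ 2"
    have L: "L > 0"
      using r p by (simp add: L_def)
    \<comment> \<open>With \<open>D\<close> the product of \<open>S\<close> and \<open>E\<close>,
      the element \<open>\<one>\<close> ensures \<open>E \<subseteq> D\<close>, while
      \<open>P\<close> and \<open>N\<close> ensure that their translates by \<open>E\<close> stay
      inside \<open>D\<close>.\<close>
    define S where "S = insert \<one> (P \<union> N)"
    have S: "finite S" "S \<subseteq> carrier G" "S \<noteq> {}"
      using P N by (auto simp: S_def)
    obtain E where E: "finite E" "E \<subseteq> carrier G" "E \<noteq> {}"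
      and LE: "L * card ((\<lambda>(s, e). s \<otimes> e) ` (S \<times> E)) \<le> (L + 1) * card E"
      using exists_almost_invariant[OF S L] by blast
    obtain T where T: "T \<subseteq> E" "disjoint_family_on (\<lambda>t. (\<lambda>p. p \<otimes> t) ` P) T"
      and ET: "card E \<le> card P ^ 2 * card T"
      using exists_packing[OF E(1,2) P Pne] by blast
    define D where "D = (\<lambda>(s, e). s \<otimes> e) ` (S \<times> E)"
    have D: "finite D" "D \<subseteq> carrier G" and SE: "\<And>s e. s \<in> S \<Longrightarrow> e \<in> E \<Longrightarrow> s \<otimes> e \<in> D"
      using S E by (auto simp: D_def)
    have "E \<subseteq> D"
    proof
      fix e assume e: "e \<in> E"
      then have "e = \<one> \<otimes> e" using E(2) by auto
      then show "e \<in> D" using SE[of \<one> e] e by (simp add: S_def)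
    qed
    then have cED: "card E \<le> card D"
      using D(1) by (rule card_mono[rotated])
    have finT: "finite T"
      using T(1) E(1) by (rule finite_subset)
    define B where "B t = (\<lambda>p. p \<otimes> t) ` P" for t
    \<comment> \<open>The forbidden pattern of \<open>w\<close> on \<open>P\<close>, transported to
      the translate \<open>B t\<close>; cancellation makes the \<open>p\<close> chosen by
      \<open>THE\<close> unique.\<close>
    define v where "v t = (\<lambda>m\<in>B t. w (THE p. p \<in> P \<and> p \<otimes> t = m))" for t
    have rc: "p' = p" if "t \<in> T" "p \<in> P" "p' \<in> P" "p' \<otimes> t = p \<otimes> t" for t p p'
      using that T(1) E(2) P(2) r_cancel[of p' t p] by blast
    have the: "(THE p'. p' \<in> P \<and> p' \<otimes> t = p \<otimes> t) = p" if "t \<in> T" "p \<in> P" for t p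
      using that rc by (intro the_equality) auto
    have cardB: "card (B t) = p" if "t \<in> T" for t
      unfolding B_def p_def using that rc by (intro card_image inj_onI) blast
    have vB: "v t \<in> B t \<rightarrow>\<^sub>E A" if "t \<in> T" for t
      using the[OF that] w(1) P(2) by (auto simp: v_def B_def)
    define X where "X = {f \<in> D \<rightarrow>\<^sub>E A. \<forall>t\<in>T. restrict f (B t) \<noteq> v t}"
    have count: "card X * q ^ card T \<le> a ^ card D * (q - 1) ^ card T"
      unfolding X_def q_def a_def
      using T cardB vB SE by (intro card_avoiding_le D A finT) (auto simp: B_def S_def)
    \<comment> \<open>Padding with the constant \<open>a0\<close> turns each pattern on
      \<open>E\<close> into a full configuration, to which \<tau> can be applied.\<close>
    define x where "x g = (\<lambda>m\<in>carrier G. if m \<in> E then g m else a0)" for g :: "'a \<Rightarrow> 'c"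
    define h where "h g = restrict (\<tau> (x g)) D" for g
    have xc: "x g \<in> configs G A" if "g \<in> E \<rightarrow>\<^sub>E A" for g
      using that a0 by (auto simp: x_def)
    have "inj_on h (E \<rightarrow>\<^sub>E A)"
    proof (rule inj_onI)
      fix f g assume fg: "f \<in> E \<rightarrow>\<^sub>E A" "g \<in> E \<rightarrow>\<^sub>E A" "h f = h g"
      show "f = g"
      proof (rule PiE_ext[OF fg(1,2)])
        fix e assume e: "e \<in> E"
        then have ec: "e \<in> carrier G" using E(2) by auto
        \<comment> \<open>The shift by \<open>e\<close> moves the cell \<open>e\<close> to
          \<open>\<one>\<close>, where the local inverse rule \<open>Nx\<close> reads it
          off.\<close>
        have "shift G e (x f) \<one> = shift G e (x g) \<one>"
        proof (rule Nx)
          fix m assume m: "m \<in> N"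
          have "m \<otimes> e \<in> D" using SE m e by (simp add: S_def)
          then have "\<tau> (x f) (m \<otimes> e) = \<tau> (x g) (m \<otimes> e)"
            using fun_cong[OF fg(3), of "m \<otimes> e"] by (simp add: h_def)
          then show "\<tau> (shift G e (x f)) m = \<tau> (shift G e (x g)) m"
            using equiv ec m N(2) xc fg by (simp add: subset_iff)
        qed (use shiftc ec xc fg in auto)
        then show "f e = g e"
          using e ec by (simp add: shift_def x_def)
      qed
    qed
    moreover have "h ` (E \<rightarrow>\<^sub>E A) \<subseteq> X"
    proof (rule image_subsetI)
      fix g assume g: "g \<in> E \<rightarrow>\<^sub>E A"
      have "restrict (h g) (B t) \<noteq> v t" if t: "t \<in> T" for t
      proof -
        have tE: "t \<in> E" "t \<in> carrier G"
          using t T(1) E(2) by auto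
        \<comment> \<open>An occurrence of the pattern at \<open>t\<close> would be an occurrence on
          \<open>P\<close> for the image of the shifted configuration, which \<open>Pw\<close>
          excludes.\<close>
        obtain m where m: "m \<in> P" "\<tau> (shift G t (x g)) m \<noteq> w m"
          using Pw[OF shiftc[OF tE(2) xc[OF g]]] by blast
        then have "\<tau> (x g) (m \<otimes> t) \<noteq> w m"
          using equiv[of t m "x g"] tE P(2) xc[OF g] by auto
        moreover have "m \<otimes> t \<in> D" "m \<otimes> t \<in> B t"
          using SE m(1) tE by (auto simp: S_def B_def)
        ultimately have "restrict (h g) (B t) (m \<otimes> t) \<noteq> v t (m \<otimes> t)"
          using the[OF t m(1)] by (simp add: h_def v_def)
        then show ?thesis by metis
      qed
      moreover have "h g \<in> D \<rightarrow>\<^sub>E A"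
        using \<tau>c[OF xc[OF g]] D(2) by (auto simp: h_def)
      ultimately show "h g \<in> X"
        by (simp add: X_def)
    qed
    moreover have "finite X"
      by (rule finite_subset[of _ "D \<rightarrow>\<^sub>E A"]) (auto simp: X_def intro!: finite_PiE D(1) A)
    ultimately have "card (E \<rightarrow>\<^sub>E A) \<le> card X"
      by (rule card_inj_on_le)
    then have "a ^ card E \<le> card X"
      using E(1) by (simp add: card_PiE a_def)
    then have "a ^ card E * q ^ card T \<le> card X * q ^ card T"
      by simp
    also note count
    \<comment> \<open>Splitting off \<open>a ^ card E\<close> allows it to be cancelled, leaving
      only the surplus cells of \<open>D\<close> to compare with the blocks.\<close>
    also have "a ^ card D * (q - 1) ^ card T
        = a ^ card E * (a ^ (card D - card E) * (q - 1) ^ card T)"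
      using cED by (simp flip: mult.assoc power_add)
    finally have ge: "q ^ card T \<le> a ^ (card D - card E) * (q - 1) ^ card T"
      using a by simp
    have "L * (card D - card E) \<le> card E"
      using LE by (simp add: D_def[symmetric] diff_mult_distrib2)
    also note ET
    finally have "p ^ 2 * (r * (card D - card E)) \<le> p ^ 2 * card T"
      by (simp only: L_def p_def mult_ac)
    then have "r * (card D - card E) \<le> card T"
      using p by simp
    moreover have "card T > 0"
      using ET E(1,3) by (metis card_gt_0_iff gr0I le_zero_eq mult_0_right)
    ultimately have "a ^ (card D - card E) * (q - 1) ^ card T < q ^ card T"
      by (rule power_mult_power_less[OF q r(2)])
    with ge show False by simp
  qed
qed

theorem corollary5p11:
  shows "(\<forall>M :: ('m, 'r) monoid_scheme. comm_monoid_cancel M \<longrightarrow> surjunctive TYPE('a) M) \<and>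
         surjunctive TYPE('a) nat_add_monoid"
  by (intro conjI allI impI comm_monoid_cancel.surjunctive comm_monoid_cancel_nat_add_monoid)

end
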